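(* Let $k$ and $n$ be integers with $k\geq 2$ and $n=4k$. Then \[ AR(n,kP_4)=(2k-1)(4k-3)+1. \]
   Context: For a positive integer $n$ and a graph $H$, the anti-Ramsey number $AR(n,H)$ is the maximum number of colors in an edge-coloring of the complete graph $K_n$ that contains no rainbow copy of $H$ (a subgraph is rainbow if all its edges receive distinct colors). $P_4$ denotes the path on $4$ vertices and $kP_4$ denotes the vertex-disjoint union of $k$ copies of $P_4$. *)

theory Defs
  imports Main
begin

record 'a ugraph =
  verts :: "'a set"
  edges :: "'a set set"

definition simple_graph :: "'a ugraph \<Rightarrow> bool" where
  "simple_graph G \<longleftrightarrow> (\<forall>e\<in>edges G. e \<subseteq> verts G \<and> card e = 2)"

definition subgraph :: "'a ugraph \<Rightarrow> 'a ugraph \<Rightarrow> bool" where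
  "subgraph F G \<longleftrightarrow> simple_graph F \<and> verts F \<subseteq> verts G \<and> edges F \<subseteq> edges G"

definition graph_iso :: "'a ugraph \<Rightarrow> 'b ugraph \<Rightarrow> bool" where
  "graph_iso G H \<longleftrightarrow>
     (\<exists>f. bij_betw f (verts G) (verts H) \<and> (\<lambda>e. f ` e) ` edges G = edges H)"

definition complete_graph :: "nat \<Rightarrow> nat ugraph" where
  "complete_graph n = \<lparr>verts = {..<n}, edges = {e. e \<subseteq> {..<n} \<and> card e = 2}\<rparr>"

text \<open>The path on \<open>m\<close> vertices (not \<open>m\<close> edges).\<close>

definition path_graph :: "nat \<Rightarrow> nat ugraph" where
  "path_graph m = \<lparr>verts = {..<m}, edges = {{i, Suc i} |i. Suc i < m}\<rparr>"

definition disjoint_copies :: "nat \<Rightarrow> 'a ugraph \<Rightarrow> (nat \<times> 'a) ugraph" where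
  "disjoint_copies k G =
     \<lparr>verts = {..<k} \<times> verts G, edges = {Pair i ` e |i e. i < k \<and> e \<in> edges G}\<rparr>"

text \<open>An edge-colouring is a function on vertex sets, of which only the values on edges matter.\<close>

definition rainbow :: "('a set \<Rightarrow> 'c) \<Rightarrow> 'a ugraph \<Rightarrow> bool" where
  "rainbow c F \<longleftrightarrow> inj_on c (edges F)"

definition has_rainbow_copy :: "('a set \<Rightarrow> 'c) \<Rightarrow> 'a ugraph \<Rightarrow> 'b ugraph \<Rightarrow> bool" where
  "has_rainbow_copy c G H \<longleftrightarrow> (\<exists>F. subgraph F G \<and> graph_iso H F \<and> rainbow c F)"

definition rainbow_free_color_counts :: "nat \<Rightarrow> 'b ugraph \<Rightarrow> nat set" where
  "rainbow_free_color_counts n H =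
     {card (c ` edges (complete_graph n)) |c :: nat set \<Rightarrow> nat.
        \<not> has_rainbow_copy c (complete_graph n) H}"

text \<open>The maximum is meaningful when some colouring avoids a rainbow \<open>H\<close>; this holds as soon as
  \<open>H\<close> has two edges, see \<open>rainbow_free_color_counts_nonempty\<close> below.\<close>

definition anti_ramsey :: "nat \<Rightarrow> 'b ugraph \<Rightarrow> nat" where
  "anti_ramsey n H = Max (rainbow_free_color_counts n H)"

lemma simple_complete_graph: "simple_graph (complete_graph n)"
  by (simp add: simple_graph_def complete_graph_def)

lemma simple_path_graph: "simple_graph (path_graph m)"
  by (auto simp: simple_graph_def path_graph_def)

lemma simple_disjoint_copies:
  assumes "simple_graph G"
  shows "simple_graph (disjoint_copies k G)"
  using assms by (fastforce simp: simple_graph_def disjoint_copies_def card_image inj_on_def)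

lemma finite_rainbow_free_color_counts: "finite (rainbow_free_color_counts n H)"
proof -
  have fin: "finite (edges (complete_graph n))"
    by (rule finite_subset[of _ "Pow {..<n}"]) (auto simp: complete_graph_def)
  have "rainbow_free_color_counts n H \<subseteq> {..card (edges (complete_graph n))}"
    using card_image_le[OF fin] by (auto simp: rainbow_free_color_counts_def)
  then show ?thesis
    by (rule finite_subset) simp
qed

lemma rainbow_free_color_counts_nonempty:
  fixes H :: "'b ugraph"
  assumes "simple_graph H" "e \<in> edges H" "e' \<in> edges H" "e \<noteq> e'"
  shows "rainbow_free_color_counts n H \<noteq> {}"
proof -
  have "\<not> has_rainbow_copy (\<lambda>_. 0 :: nat) (complete_graph n) H"
  proof
    assume "has_rainbow_copy (\<lambda>_. 0 :: nat) (complete_graph n) H"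
    then obtain F :: "nat ugraph" and f where f: "bij_betw f (verts H) (verts F)"
        "(\<lambda>e. f ` e) ` edges H = edges F" "inj_on (\<lambda>_. 0 :: nat) (edges F)"
      by (auto simp: has_rainbow_copy_def graph_iso_def rainbow_def)
    have "f ` e \<in> edges F" "f ` e' \<in> edges F"
      using f(2) assms(2,3) by blast+
    then have "f ` e = f ` e'"
      using f(3) by (auto simp: inj_on_def)
    moreover have "e \<subseteq> verts H" "e' \<subseteq> verts H"
      using assms(1-3) by (auto simp: simple_graph_def)
    ultimately show False
      using f(1) assms(4) by (metis bij_betw_def inj_on_image_eq_iff)
  qed
  then show ?thesis
    by (auto simp: rainbow_free_color_counts_def)
qed

end

(* A colouring of K_n, n = 4k, with (n-2 choose 2) + 2 colours has a rainbow spanning subgraph E with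
   one edge per colour, which misses at most 2n - 5 edges.  A Chvatal-type degree condition shows
   that E has a Hamiltonian path, hence a P4-factor, unless it has an isolated vertex, or two
   vertices of degree at most 1, or n = 8 and five vertices of degree at most 3.  In these cases one
   puts a missing edge f into E in place of the edge of E with the same colour; for suitable f the
   new subgraph has a P4-factor.  Conversely, colour a clique on n - 2 vertices with distinct colours
   and all other edges with one further colour: a spanning copy of kP4 has two edges that meet the
   two remaining vertices. *)
theory Submission imports Defs begin

section \<open>Edge sets on a vertex set and their degrees\<close>

definition pairs :: "'a set \<Rightarrow> 'a set set" where
  "pairs V = {e. e \<subseteq> V \<and> card e = 2}"

text \<open>Takes a bare edge set because it is applied to a graph \<open>E\<close> and also to its
  missing edges \<open>pairs V - E\<close>.\<close>

definition degree :: "'a set set \<Rightarrow> 'a \<Rightarrow> nat" where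
  "degree E v = card {e \<in> E. v \<in> e}"

definition traceable :: "'a set \<Rightarrow> 'a set set \<Rightarrow> bool" where
  "traceable V E \<longleftrightarrow>
     (\<exists>p. distinct p \<and> set p = V \<and> successively (\<lambda>x y. {x, y} \<in> E) p)"

lemma finite_pairs: "finite V \<Longrightarrow> finite (pairs V)"
  by (rule finite_subset[of _ "Pow V"]) (auto simp: pairs_def)

lemma card_pairs: "finite V \<Longrightarrow> card (pairs V) = card V choose 2"
  unfolding pairs_def by (rule n_subsets)

lemma doubleton_in_pairs: "{x, y} \<in> pairs V \<longleftrightarrow> x \<in> V \<and> y \<in> V \<and> x \<noteq> y"
  by (auto simp: pairs_def card_2_iff doubleton_eq_iff)

lemma pairs_cases:
  assumes "e \<in> pairs V" "v \<in> e"
  obtains w where "w \<in> V" "w \<noteq> v" "v \<in> V" "e = {v, w}"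
  using assms by (force simp: pairs_def card_2_iff)

lemma degree_eq_card_neighbours:
  assumes "E \<subseteq> pairs V"
  shows "degree E v = card {w. {v, w} \<in> E}"
proof -
  have "bij_betw (\<lambda>w. {v, w}) {w. {v, w} \<in> E} {e \<in> E. v \<in> e}"
    unfolding bij_betw_def
  proof
    show "inj_on (\<lambda>w. {v, w}) {w. {v, w} \<in> E}"
      by (auto simp: inj_on_def doubleton_eq_iff)
    show "(\<lambda>w. {v, w}) ` {w. {v, w} \<in> E} = {e \<in> E. v \<in> e}"
      using assms by (fastforce elim!: pairs_cases)
  qed
  then show ?thesis by (simp add: degree_def bij_betw_same_card)
qed

lemma degree_mono: "E \<subseteq> F \<Longrightarrow> finite F \<Longrightarrow> degree E v \<le> degree F v"
  unfolding degree_def by (rule card_mono) auto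

lemma degree_pairs:
  assumes "finite V" "v \<in> V"
  shows "degree (pairs V) v = card V - 1"
proof -
  have "{w. {v, w} \<in> pairs V} = V - {v}"
    using assms by (auto simp: doubleton_in_pairs)
  then show ?thesis
    using assms degree_eq_card_neighbours[of "pairs V" V v] by simp
qed

lemma degree_complement:
  assumes "finite V" "v \<in> V" "E \<subseteq> pairs V"
  shows "degree E v + degree (pairs V - E) v = card V - 1"
proof -
  have fin: "finite E" using assms finite_pairs finite_subset by blast
  have "{e \<in> E. v \<in> e} \<union> {e \<in> pairs V - E. v \<in> e} = {e \<in> pairs V. v \<in> e}"
    using assms by auto
  then have "card {e \<in> pairs V. v \<in> e} = card {e \<in> E. v \<in> e} + card {e \<in> pairs V - E. v \<in> e}"
    using fin finite_pairs[OF assms(1)] by (subst card_Un_disjoint[symmetric]) auto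
  then show ?thesis using degree_pairs[OF assms(1,2)] by (simp add: degree_def)
qed

section \<open>Hamiltonian paths and a degree sequence condition for them\<close>

lemma traceable_pairs:
  assumes "finite V"
  shows "traceable V (pairs V)"
proof -
  obtain p where p: "set p = V" "distinct p"
    using finite_distinct_list[OF assms] by blast
  have "successively (\<lambda>x y. {x, y} \<in> pairs V) p"
    unfolding successively_conv_nth doubleton_in_pairs
    using p nth_eq_iff_index_eq[OF p(2)] nth_mem[of _ p] by fastforce
  with p show ?thesis unfolding traceable_def by blast
qed

text \<open>A Hamiltonian path \<open>us @ vs\<close> that uses the non-edge from \<open>u = last us\<close> to \<open>v = hd vs\<close>
  can be repaired as soon as some neighbour of \<open>u\<close> is followed by a neighbour of \<open>v\<close>, or \<open>u\<close> is adjacent to the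
  last vertex, or \<open>v\<close> to the first one.\<close>

lemma degree_sum_nontraceable:
  assumes fin: "finite V" and E: "E \<subseteq> pairs V" and nt: "\<not> traceable V E"
    and tr: "traceable V (insert {u, v} E)"
  shows "degree E u + degree E v + 2 \<le> card V"
proof -
  define R where "R = (\<lambda>x y. {x, y} \<in> E)"
  have Rsym: "R x y = R y x" for x y by (simp add: R_def insert_commute)
  have Rirr: "\<not> R x x" for x
    using E by (auto simp: R_def pairs_def)
  have RV: "y \<in> V" if "R x y" for x y
    using that E doubleton_in_pairs[of x y V] by (auto simp: R_def)
  have "(\<lambda>x y. R y x) = R" by (simp add: fun_eq_iff Rsym[symmetric])
  then have rev: "successively R (rev xs) = successively R xs" for xs
    unfolding successively_rev by (rule arg_cong)
  have no: False if "distinct p" "set p = V" "successively R p" for p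
    using that nt unfolding traceable_def R_def by blast
  obtain p where p: "distinct p" "set p = V"
    "successively (\<lambda>x y. {x, y} \<in> insert {u, v} E) p"
    using tr unfolding traceable_def by blast
  have "\<not> successively R p" using no p by blast
  then obtain i where i: "Suc i < length p" "\<not> R (p ! i) (p ! Suc i)"
    by (auto simp: successively_conv_nth)
  \<comment> \<open>Since \<open>p\<close> is not a path in \<open>E\<close>, it uses the added
    pair; as \<open>p\<close> is distinct, it does so at position \<open>i\<close> only.\<close>
  have uv: "{p ! i, p ! Suc i} = {u, v}"
    using p(3) i by (auto simp: successively_conv_nth R_def)
  have R: "R (p ! j) (p ! Suc j)" if "Suc j < length p" "j \<noteq> i" for j
  proof -
    have "{p ! j, p ! Suc j} \<noteq> {p ! i, p ! Suc i}"
      using that i(1) p(1) by (auto simp: doubleton_eq_iff nth_eq_iff_index_eq)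
    then show ?thesis using p(3) that uv by (auto simp: successively_conv_nth R_def)
  qed
  let ?u = "p ! i" and ?v = "p ! Suc i" and ?n = "length p"
  have n: "?n = card V" using p distinct_card by fastforce
  have sl: "successively R (take m (drop l p))" if "i < l \<or> l + m \<le> Suc i" for l m
    using that R by (auto simp: successively_conv_nth)
  define us vs where us: "us = take (Suc i) p" and vs: "vs = drop (Suc i) p"
  have usvs: "us \<noteq> []" "vs \<noteq> []" "last us = ?u" "hd vs = ?v"
    using i(1) by (auto simp: us vs take_Suc_conv_app_nth hd_drop_conv_nth)
  have sx: "successively R us" using sl[of 0 "Suc i"] by (simp add: us)
  have sy: "successively R vs" using sl[of "Suc i" "?n"] i(1) by (simp add: vs)
  have dist: "distinct (us @ vs)" "set (us @ vs) = V"
    using p by (simp_all add: us vs del: set_append distinct_append)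
  have step: "\<not> (R ?u (p ! j) \<and> R ?v (p ! Suc j))" if "Suc j < ?n" for j
  proof
    assume a: "R ?u (p ! j) \<and> R ?v (p ! Suc j)"
    then have a': "R (p ! j) ?u" "R (p ! Suc j) ?v" using Rsym by blast+
    then have "j \<noteq> i" "j \<noteq> Suc i" using Rirr i a by auto
    then consider "j < i" | "Suc i < j" by linarith
    then show False
    proof cases
      case 1
      \<comment> \<open>Reversing the segment \<open>zs\<close> from \<open>p ! Suc j\<close> to
        \<open>?u\<close> trades the steps at \<open>j\<close> and at \<open>i\<close> for the edges
        from \<open>p ! j\<close> to \<open>?u\<close> and from \<open>p ! Suc j\<close> to
        \<open>?v\<close>.\<close>
      define as zs where "as = take j us" and "zs = drop (Suc j) us"
      have dec: "us = as @ p ! j # zs"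
        using 1 i(1) id_take_nth_drop[of j us] by (simp add: as_def zs_def us)
      have zs: "zs \<noteq> []" "last zs = ?u" "hd zs = p ! Suc j"
        using 1 i(1) usvs by (auto simp: zs_def us hd_drop_conv_nth last_drop)
      have "successively R (as @ p ! j # rev zs @ vs)"
        using sx sy a' zs usvs unfolding dec
        by (auto simp: successively_append_iff successively_Cons rev last_rev hd_rev simp del: successively_rev)
      moreover have "distinct (as @ p ! j # rev zs @ vs)" "set (as @ p ! j # rev zs @ vs) = V"
        using dist unfolding dec by auto
      ultimately show False using no by blast
    next
      case 2
      \<comment> \<open>Here the segment from \<open>?v\<close> to \<open>p ! j\<close> is reversed.
        It has \<open>j - i\<close> entries because \<open>vs\<close> starts at position
        \<open>Suc i\<close>.\<close>
      define zs bs where "zs = take (j - i) vs" and "bs = drop (j - i) vs"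
      have dec: "vs = zs @ bs" by (simp add: zs_def bs_def)
      have bs: "bs \<noteq> []" "hd bs = p ! Suc j"
        using 2 that by (auto simp: bs_def vs hd_drop_conv_nth)
      have zs: "zs \<noteq> []" "hd zs = ?v" "last zs = p ! j"
        using 2 that by (auto simp: zs_def vs hd_drop_conv_nth last_conv_nth)
      have "successively R (us @ rev zs @ bs)"
        using sx sy a bs zs usvs unfolding dec
        by (auto simp: successively_append_iff rev last_rev hd_rev simp del: successively_rev)
      moreover have "distinct (us @ rev zs @ bs)" "set (us @ rev zs @ bs) = V"
        using dist unfolding dec by auto
      ultimately show False using no by blast
    qed
  qed
  have last: "\<not> R ?u (p ! j)" if "Suc j = ?n" for j
  proof
    assume a: "R ?u (p ! j)"
    have "p \<noteq> []" "j = length p - 1" using that i(1) by auto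
    then have "last p = p ! j" by (simp add: last_conv_nth)
    then have "last vs = p ! j" using i(1) by (simp add: vs last_drop)
    then have "successively R (us @ rev vs)"
      using sx sy a usvs by (auto simp: successively_append_iff rev hd_rev simp del: successively_rev)
    moreover have "distinct (us @ rev vs)" "set (us @ rev vs) = V" using dist by auto
    ultimately show False using no by blast
  qed
  have first: "\<not> R ?v (p ! 0)"
  proof
    assume a: "R ?v (p ! 0)"
    have "p \<noteq> []" using i(1) by auto
    then have "hd us = p ! 0" by (simp add: us hd_take hd_conv_nth)
    then have "successively R (rev us @ vs)"
      using sx sy a Rsym[of ?v "p ! 0"] usvs
      by (auto simp: successively_append_iff rev last_rev simp del: successively_rev)
    moreover have "distinct (rev us @ vs)" "set (rev us @ vs) = V" using dist by auto
    ultimately show False using no by blast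
  qed
  have deg: "degree E x = card {j. j < ?n \<and> R x (p ! j)}" for x
  proof -
    have "{w. {x, w} \<in> E} = (!) p ` {j. j < ?n \<and> R x (p ! j)}"
      using RV[of x] p(2) unfolding R_def by (auto simp: image_iff in_set_conv_nth) (metis in_set_conv_nth)
    moreover have "inj_on ((!) p) {j. j < ?n \<and> R x (p ! j)}"
      using p(1) by (auto simp: inj_on_def nth_eq_iff_index_eq)
    ultimately show ?thesis
      using degree_eq_card_neighbours[OF E] by (simp add: card_image)
  qed
  \<comment> \<open>The positions after neighbours of \<open>?u\<close> are disjoint from the
    positions of neighbours of \<open>?v\<close>, by \<open>step\<close>. Both sets lie below
    \<open>?n\<close> by \<open>last\<close>, avoid 0 by \<open>first\<close>, and avoid
    \<open>Suc i\<close> by irreflexivity, so they share \<open>?n - 2\<close> places.\<close>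
  let ?I = "{j. j < ?n \<and> R ?u (p ! j)}" and ?J = "{j. j < ?n \<and> R ?v (p ! j)}"
  have "Suc ` ?I \<inter> ?J = {}" using step by auto
  moreover have "Suc ` ?I \<union> ?J \<subseteq> {1..<?n} - {Suc i}"
  proof
    fix j assume "j \<in> Suc ` ?I \<union> ?J"
    then show "j \<in> {1..<?n} - {Suc i}"
    proof
      assume "j \<in> Suc ` ?I"
      then obtain l where l: "j = Suc l" "l < ?n" "R ?u (p ! l)" by blast
      then have "Suc l \<noteq> ?n" "l \<noteq> i" using last Rirr by blast+
      then show ?thesis using l by auto
    next
      assume "j \<in> ?J"
      then show ?thesis using first Rirr by (cases j) auto
    qed
  qed
  ultimately have "card (Suc ` ?I) + card ?J \<le> card ({1..<?n} - {Suc i})"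
    by (metis (no_types, lifting) card_Un_disjoint card_mono finite_Diff finite_Un finite_atLeastLessThan finite_subset)
  moreover have "card ({1..<?n} - {Suc i}) = ?n - 2" using i(1) by simp
  moreover have "card (Suc ` ?I) = card ?I" by (simp add: card_image)
  ultimately have "degree E ?u + degree E ?v + 2 \<le> card V"
    using i(1) n by (simp add: deg)
  then show ?thesis using uv by (auto simp: doubleton_eq_iff)
qed

text \<open>In an edge-maximal nontraceable supergraph \<open>C\<close>, every nonadjacent pair has
  degree sum at most \<open>card V - 2\<close>. Take such a pair \<open>u\<close>, \<open>v\<close>
  of largest degree sum with \<open>u\<close> of the smaller degree \<open>h\<close>. By this choice
  the non-neighbours of \<open>v\<close> have degree at most \<open>h\<close>, while
  \<open>u\<close> and its non-neighbours have degree at most that of \<open>v\<close>. Degrees in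
  \<open>E\<close> are no larger than in \<open>C\<close>.\<close>

lemma nontraceable_degree_sequence:
  assumes fin: "finite V" and E: "E \<subseteq> pairs V" and nt: "\<not> traceable V E"
  obtains h where "2 * h + 2 \<le> card V" "h + 1 \<le> card {w \<in> V. degree E w \<le> h}"
    "card V - h \<le> card {w \<in> V. degree E w + h + 2 \<le> card V}"
proof -
  define \<C> where "\<C> = {C. E \<subseteq> C \<and> C \<subseteq> pairs V \<and> \<not> traceable V C}"
  have "finite \<C>" "\<C> \<noteq> {}"
    using E nt finite_pairs[OF fin] by (auto simp: \<C>_def intro: finite_subset[of _ "Pow (pairs V)"])
  then obtain C where C: "C \<in> \<C>" "\<And>D. D \<in> \<C> \<Longrightarrow> C \<subseteq> D \<Longrightarrow> C = D"
    using finite_has_maximal by metis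
  then have CE: "E \<subseteq> C" "C \<subseteq> pairs V" "\<not> traceable V C" by (auto simp: \<C>_def)
  have finC: "finite C" using CE(2) finite_pairs[OF fin] finite_subset by blast
  let ?d = "degree C" and ?n = "card V"
  \<comment> \<open>Ordered pairs, so that each nonadjacent pair can be named with the vertex of
    smaller degree first.\<close>
  define N where "N = {(u, v). u \<in> V \<and> v \<in> V \<and> u \<noteq> v \<and> {u, v} \<notin> C}"
  have sum: "?d u + ?d v + 2 \<le> ?n" if "(u, v) \<in> N" for u v
  proof (rule degree_sum_nontraceable[OF fin CE(2,3)], rule ccontr)
    assume "\<not> traceable V (insert {u, v} C)"
    then have "insert {u, v} C \<in> \<C>"
      using that CE by (auto simp: \<C>_def N_def doubleton_in_pairs)
    then show False using C(2)[of "insert {u, v} C"] that by (auto simp: N_def)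
  qed
  have "N \<noteq> {}"
  proof
    assume "N = {}"
    then have "pairs V \<subseteq> C" by (auto simp: N_def pairs_def card_2_iff)
    then show False using CE traceable_pairs[OF fin] by auto
  qed
  moreover have "finite N" using fin by (auto simp: N_def intro: finite_subset[of _ "V \<times> V"])
  ultimately obtain z where "z \<in> N"
    "?d (fst z) + ?d (snd z) = Max ((\<lambda>y. ?d (fst y) + ?d (snd y)) ` N)"
    using Max_in[of "(\<lambda>y. ?d (fst y) + ?d (snd y)) ` N"] by fastforce
  with \<open>finite N\<close> have z: "z \<in> N"
    "\<And>y. y \<in> N \<Longrightarrow> ?d (fst y) + ?d (snd y) \<le> ?d (fst z) + ?d (snd z)"
    by simp_all
  have sym: "(a, b) \<in> N \<Longrightarrow> (b, a) \<in> N" for a b by (auto simp: N_def insert_commute)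
  obtain u v where uv: "(u, v) \<in> N" "?d u \<le> ?d v"
    "\<And>a b. (a, b) \<in> N \<Longrightarrow> ?d a + ?d b \<le> ?d u + ?d v"
  proof (cases "?d (fst z) \<le> ?d (snd z)")
    case True
    then show ?thesis using that[of "fst z" "snd z"] z by force
  next
    case False
    then show ?thesis using that[of "snd z" "fst z"] z sym[of "fst z" "snd z"]
      by (force simp: add.commute)
  qed
  have nonadj: "card {w. (w, x) \<in> N} + ?d x + 1 = ?n" if "x \<in> V" for x
  proof -
    have "{w. {x, w} \<in> C} \<subseteq> V - {x}" using CE(2) doubleton_in_pairs[of x _ V] by blast
    moreover have "{w. (w, x) \<in> N} = (V - {x}) - {w. {x, w} \<in> C}"
      using that by (auto simp: N_def insert_commute[of _ x])
    ultimately have "card {w. (w, x) \<in> N} = card (V - {x}) - card {w. {x, w} \<in> C}"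
      "card {w. {x, w} \<in> C} \<le> card (V - {x})"
      using fin by (auto intro: card_Diff_subset finite_subset card_mono)
    then show ?thesis
      using that fin degree_eq_card_neighbours[OF CE(2), of x] card_gt_0_iff[of V] by auto
  qed
  have le: "degree E w \<le> ?d w" for w using degree_mono[OF CE(1) finC] .
  have uvV: "u \<in> V" "v \<in> V" using uv(1) by (auto simp: N_def)
  have s: "?d u + ?d v + 2 \<le> ?n" using sum uv(1) by blast
  show ?thesis
  proof (rule that[of "?d u"])
    show "2 * ?d u + 2 \<le> ?n" using s uv(2) by simp
    have "{w. (w, v) \<in> N} \<subseteq> {w \<in> V. degree E w \<le> ?d u}"
    proof safe
      fix w assume "(w, v) \<in> N"
      then show "w \<in> V" "degree E w \<le> ?d u"
        using uv(3)[of w v] le[of w] by (auto simp: N_def)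
    qed
    then have "card {w. (w, v) \<in> N} \<le> card {w \<in> V. degree E w \<le> ?d u}"
      using fin by (intro card_mono) auto
    then show "?d u + 1 \<le> card {w \<in> V. degree E w \<le> ?d u}"
      using nonadj[OF uvV(2)] s by linarith
    have "degree E w + ?d u + 2 \<le> ?n" if "(w, u) \<in> N" for w
      using uv(3)[OF that] le[of w] s by linarith
    moreover have "degree E u + ?d u + 2 \<le> ?n" using le[of u] s uv(2) by linarith
    ultimately have "insert u {w. (w, u) \<in> N} \<subseteq> {w \<in> V. degree E w + ?d u + 2 \<le> ?n}"
      using uvV by (auto simp: N_def)
    then have "card (insert u {w. (w, u) \<in> N}) \<le> card {w \<in> V. degree E w + ?d u + 2 \<le> ?n}"
      using fin by (intro card_mono) auto
    moreover have "finite {w. (w, u) \<in> N}"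
      using fin by (rule finite_subset[rotated]) (auto simp: N_def)
    moreover have "u \<notin> {w. (w, u) \<in> N}" by (auto simp: N_def)
    ultimately show "?n - ?d u \<le> card {w \<in> V. degree E w + ?d u + 2 \<le> ?n}"
      using nonadj[OF uvV(1)] by simp
  qed
qed

section \<open>Counting missing edges\<close>

text \<open>An edge with 0, 1 or 2 ends in \<open>A\<close> contributes 1, 1 or 2 to both
  sides.\<close>

lemma sum_degree:
  assumes "finite M" "finite A" "\<forall>e\<in>M. card e = 2"
  shows "(\<Sum>a\<in>A. degree M a) + card {e \<in> M. e \<inter> A = {}} = card M + card {e \<in> M. e \<subseteq> A}"
proof -
  have one: "card (A \<inter> e) + (if e \<inter> A = {} then 1 else 0) = 1 + (if e \<subseteq> A then 1 else 0)"
    if e: "card e = 2" for e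
  proof -
    obtain x y where "e = {x, y}" "x \<noteq> y" using e by (auto simp: card_2_iff)
    then show ?thesis by (cases "x \<in> A"; cases "y \<in> A") (auto simp: Int_insert_right)
  qed
  have count: "card {x \<in> S. Q x} = (\<Sum>x\<in>S. if Q x then 1 else 0)" if "finite S" for S :: "'b set" and Q
    using that by (simp add: sum.inter_filter[symmetric])
  have "(\<Sum>a\<in>A. degree M a) = (\<Sum>a\<in>A. \<Sum>e\<in>M. if a \<in> e then 1 else 0)"
    by (simp add: degree_def count assms)
  also have "\<dots> = (\<Sum>e\<in>M. \<Sum>a\<in>A. if a \<in> e then 1 else 0)" by (rule sum.swap)
  also have "\<dots> = (\<Sum>e\<in>M. card (A \<inter> e))"
    using assms(2) by (simp add: count[symmetric] Int_def)
  finally have "(\<Sum>a\<in>A. degree M a) + card {e \<in> M. e \<inter> A = {}}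
      = (\<Sum>e\<in>M. card (A \<inter> e) + (if e \<inter> A = {} then 1 else 0))"
    by (simp add: count assms sum.distrib)
  also have "\<dots> = (\<Sum>e\<in>M. 1 + (if e \<subseteq> A then 1 else 0))"
    using assms(3) by (intro sum.cong refl one) auto
  also have "\<dots> = card M + card {e \<in> M. e \<subseteq> A}"
    by (simp add: count assms sum.distrib del: One_nat_def)
  finally show ?thesis .
qed

text \<open>Only the edges inside \<open>A\<close> are counted twice, and there are at most
  \<open>card A choose 2\<close> of them. Applied to missing edges, this bounds how many vertices
  can have low degree.\<close>

lemma sum_degree_le:
  assumes "finite M" "finite A" "\<forall>e\<in>M. card e = 2" "\<And>a. a \<in> A \<Longrightarrow> d \<le> degree M a"
  shows "card A * d \<le> card M + (card A choose 2)"
proof -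
  have "card A * d \<le> (\<Sum>a\<in>A. degree M a)"
    using sum_bounded_below[of A d "degree M"] assms(4) by simp
  also have "\<dots> \<le> card M + card {e \<in> M. e \<subseteq> A}"
    using sum_degree[OF assms(1-3)] by linarith
  also have "card {e \<in> M. e \<subseteq> A} \<le> card (pairs A)"
    using assms by (intro card_mono finite_pairs) (auto simp: pairs_def)
  finally show ?thesis using assms(2) by (simp add: card_pairs)
qed

text \<open>The cases are the values of \<open>h\<close> in the degree sequence condition: 0 gives
  \<open>isolated\<close>, 1 gives \<open>two_leaves\<close>. For larger \<open>h\<close>, each of
  \<open>h + 1\<close> vertices misses at least \<open>card V - 1 - h\<close> edges, which exceeds
  the allowed total except when \<open>card V = 8\<close> and \<open>h = 3\<close>.\<close>

lemma nontraceable_dense: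
  assumes fin: "finite V" and n: "card V = 8 \<or> 11 \<le> card V" and E: "E \<subseteq> pairs V"
    and M: "card (pairs V - E) + 5 \<le> 2 * card V" and nt: "\<not> traceable V E"
  obtains (isolated) v where "v \<in> V" "degree E v = 0"
    | (two_leaves) u v where "u \<in> V" "v \<in> V" "u \<noteq> v" "degree E u \<le> 1" "degree E v \<le> 1"
    | (five) A where "card V = 8" "A \<subseteq> V" "card A = 5" "\<And>a. a \<in> A \<Longrightarrow> degree E a \<le> 3"
proof -
  let ?n = "card V"
  obtain h where h: "2 * h + 2 \<le> ?n" "h + 1 \<le> card {w \<in> V. degree E w \<le> h}"
    "?n - h \<le> card {w \<in> V. degree E w + h + 2 \<le> ?n}"
    using nontraceable_degree_sequence[OF fin E nt] by blast
  from h(2) obtain A where A: "A \<subseteq> {w \<in> V. degree E w \<le> h}" "card A = h + 1"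
    and finA: "finite A"
    by (rule obtain_subset_with_card_n)
  consider "h = 0" | "h = 1" | "h \<ge> 2" by linarith
  then show ?thesis
  proof cases
    case 1
    then show ?thesis using A isolated by (auto simp: card_1_singleton_iff)
  next
    case 2
    then have "card A = 2" using A(2) by simp
    then obtain u v where "A = {u, v}" "u \<noteq> v" by (auto simp: card_2_iff)
    then show ?thesis using 2 A two_leaves[of u v] by auto
  next
    case 3
    have card2: "\<forall>e\<in>pairs V - E. card e = 2" by (simp add: pairs_def)
    have "?n - 1 - h \<le> degree (pairs V - E) a" if "a \<in> A" for a
      using degree_complement[OF fin _ E, of a] A that by auto
    then have "(h + 1) * (?n - 1 - h) \<le> card (pairs V - E) + ((h + 1) choose 2)"
      using sum_degree_le[of "pairs V - E" A "?n - 1 - h"] finA A(2) finite_pairs[OF fin] card2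
      by simp
    moreover have "2 * ((h + 1) choose 2) = (h + 1) * h" by (simp add: choose_two)
    ultimately have "2 * ((h + 1) * (?n - 1 - h)) + 10 \<le> 4 * ?n + (h + 1) * h"
      using M by linarith
    moreover obtain m where m: "?n = m + h + 1" using h(1)
      by (metis add.assoc add_leD2 le_iff_add mult_2 add.commute one_add_one)
    ultimately have "2 * ((h + 1) * m) + 10 \<le> 4 * (m + h + 1) + (h + 1) * h" by simp
    then have le: "2 * (int h + 1) * int m + 10 \<le> 4 * (int m + int h + 1) + (int h + 1) * int h"
      by (simp only: of_nat_le_iff[symmetric, where 'a=int] of_nat_add of_nat_mult of_nat_numeral of_nat_1 mult.assoc)
    \<comment> \<open>\<open>le\<close> amounts to
      \<open>2 * (h - 1) * m \<le> (h - 1) * (h + 6)\<close>; together with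
      \<open>m \<ge> h + 1\<close> this leaves \<open>h \<le> 4\<close>.\<close>
    have "h \<le> 4"
    proof (rule ccontr)
      assume "\<not> h \<le> 4"
      then have "0 \<le> (int h - 5) * int h" by simp
      moreover have "0 \<le> (int m - int h - 1) * (int h - 1)"
        using m h(1) \<open>\<not> h \<le> 4\<close> by simp
      ultimately show False using le by (simp add: algebra_simps)
    qed
    then have "h = 2 \<or> h = 3 \<or> h = 4" using 3 by auto
    \<comment> \<open>\<open>h = 2\<close> would force at most 7 vertices, and \<open>h = 4\<close>
      exactly 10, a size excluded by the assumption \<open>n\<close>.\<close>
    then have "?n = 8" "h = 3" using le n m h(1) by auto
    \<comment> \<open>The last condition on \<open>h\<close> yields five vertices here, one more
      than the condition that gave \<open>A\<close>.\<close>
    then have "5 \<le> card {w \<in> V. degree E w \<le> 3}" using h(3) by simp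
    then obtain B where "B \<subseteq> {w \<in> V. degree E w \<le> 3}" "card B = 5" "finite B"
      by (rule obtain_subset_with_card_n)
    then show ?thesis using five[of B] \<open>?n = 8\<close> by auto
  qed
qed

section \<open>Rainbow spanning subgraphs and the exchange of edges\<close>

text \<open>A transversal of the colour classes: exactly one edge of each colour that
  occurs.\<close>

definition representing :: "('a set \<Rightarrow> 'c) \<Rightarrow> 'a set \<Rightarrow> 'a set set \<Rightarrow> bool" where
  "representing c V E \<longleftrightarrow> E \<subseteq> pairs V \<and> inj_on c E \<and> c ` E = c ` pairs V"

text \<open>The paths of the factor are the successive blocks of four entries of \<open>p\<close>.\<close>

definition P4_factor :: "'a set \<Rightarrow> 'a set set \<Rightarrow> bool" where
  "P4_factor V E \<longleftrightarrow> (\<exists>p. distinct p \<and> set p = V \<and>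
     (\<forall>i. Suc i < length p \<and> i mod 4 \<noteq> 3 \<longrightarrow> {p ! i, p ! Suc i} \<in> E))"

lemma traceable_imp_P4_factor: "traceable V E \<Longrightarrow> P4_factor V E"
  unfolding traceable_def P4_factor_def by (auto simp: successively_conv_nth)

text \<open>Stated with sums on both sides to avoid truncated subtraction.\<close>

lemma degree_swap:
  assumes "finite E" "e \<in> E" "f \<notin> E"
  shows "degree (insert f (E - {e})) w + (if w \<in> e then 1 else 0)
    = degree E w + (if w \<in> f then 1 else 0)"
proof -
  have "{e' \<in> insert f (E - {e}). w \<in> e'} =
     (if w \<in> f then insert f ({e' \<in> E. w \<in> e'} - {e}) else {e' \<in> E. w \<in> e'} - {e})" by auto
  moreover have "card ({e' \<in> E. w \<in> e'} - {e}) + (if w \<in> e then 1 else 0) = card {e' \<in> E. w \<in> e'}"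
    using assms card_Suc_Diff1[of "{e' \<in> E. w \<in> e'}" e] by auto
  ultimately show ?thesis using assms by (auto simp: degree_def)
qed

lemma representing_card:
  assumes "finite V" "representing c V E"
  shows "card (pairs V - E) + card (c ` pairs V) = card V choose 2"
proof -
  have "finite E"
    using assms finite_subset[OF _ finite_pairs[OF assms(1)]] by (simp add: representing_def)
  moreover have "card E = card (c ` pairs V)"
    using assms(2) card_image unfolding representing_def by metis
  moreover have "card E \<le> card (pairs V)"
    using assms by (auto simp: representing_def intro!: card_mono finite_pairs)
  ultimately show ?thesis
    using assms by (simp add: card_Diff_subset representing_def card_pairs)
qed

text \<open>The colour of \<open>f\<close> occurs on one edge \<open>e\<close> of \<open>E\<close>,
  and \<open>f\<close> can replace it. There is no control over which edge is lost, so every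
  application must cope with an arbitrary \<open>e\<close>.\<close>

lemma representing_swap:
  assumes "representing c V E" "f \<in> pairs V" "f \<notin> E"
  obtains e where "e \<in> E" "representing c V (insert f (E - {e}))"
proof -
  have "c f \<in> c ` E" using assms(1,2) by (simp add: representing_def)
  then obtain e where e: "e \<in> E" "c f = c e" by blast
  have "c ` insert f (E - {e}) = c ` E" using e by auto
  moreover have "inj_on c (insert f (E - {e}))"
    using assms(1) e by (auto simp: representing_def inj_on_def)
  ultimately show ?thesis
    using that[OF e(1)] assms by (auto simp: representing_def)
qed

section \<open>Excluding the three exceptional degree patterns\<close>

text \<open>The setting of a hypothetical counterexample.\<close>

locale dense_colouring =
  fixes V :: "'a set" and c :: "'a set \<Rightarrow> 'c"
  assumes finite_V: "finite V" and card_V: "card V = 8 \<or> 11 \<le> card V"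
    and many_colours: "(card V choose 2) + 5 \<le> card (c ` pairs V) + 2 * card V"
    and no_factor: "\<And>E. representing c V E \<Longrightarrow> \<not> P4_factor V E"
begin

text \<open>\<open>many_colours\<close> says that there are at least
  \<open>((card V - 2) choose 2) + 2\<close> colours.\<close>

lemma few_missing: "representing c V E \<Longrightarrow> card (pairs V - E) + 5 \<le> 2 * card V"
  using representing_card[OF finite_V, of c E] many_colours by linarith

lemma nontraceable: "representing c V E \<Longrightarrow> \<not> traceable V E"
  using no_factor traceable_imp_P4_factor by blast

lemma rep_subset: "representing c V E \<Longrightarrow> E \<subseteq> pairs V"
  by (simp add: representing_def)

lemma rep_finite: "representing c V E \<Longrightarrow> finite E"
  using rep_subset finite_pairs[OF finite_V] finite_subset by blast

lemma missing_facts: "finite (pairs V - E)" "\<forall>e\<in>pairs V - E. card e = 2"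
  using finite_pairs[OF finite_V] by (auto simp: pairs_def)

text \<open>Two such vertices already account for \<open>2 * card V - 5\<close> missing edges, the
  most allowed. So \<open>{u, v}\<close> is missing, both degrees are exactly 1 and every missing
  edge meets \<open>{u, v}\<close>. Putting \<open>{u, v}\<close> into \<open>E\<close> destroys all
  three exceptional patterns, whichever edge is lost.\<close>

lemma no_two_leaves:
  assumes E: "representing c V E" and uv: "u \<in> V" "v \<in> V" "u \<noteq> v"
    and deg: "degree E u \<le> 1" "degree E v \<le> 1"
  shows False
proof -
  let ?M = "pairs V - E" and ?n = "card V"
  have n: "8 \<le> ?n" using card_V by auto
  have dM: "degree E w + degree ?M w = ?n - 1" if "w \<in> V" for w
    using degree_complement[OF finite_V that rep_subset[OF E]] .
  have "{e \<in> ?M. e \<subseteq> {u, v}} \<subseteq> {{u, v}}"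
    using uv by (auto simp: pairs_def card_2_iff)
  then have in_le: "card {e \<in> ?M. e \<subseteq> {u, v}} \<le> 1"
    using card_mono[of "{{u, v}}"] by fastforce
  have sum: "degree ?M u + degree ?M v + card {e \<in> ?M. e \<inter> {u, v} = {}} =
      card ?M + card {e \<in> ?M. e \<subseteq> {u, v}}"
    using sum_degree[OF missing_facts(1) _ missing_facts(2), of "{u, v}" E] uv by simp
  then have eqs: "card {e \<in> ?M. e \<inter> {u, v} = {}} = 0" "card {e \<in> ?M. e \<subseteq> {u, v}} = 1"
    "degree E u = 1" "degree E v = 1"
    using dM[OF uv(1)] dM[OF uv(2)] deg few_missing[OF E] in_le n by linarith+
  from eqs(2) \<open>_ \<subseteq> {{u, v}}\<close> have f: "{u, v} \<in> pairs V" "{u, v} \<notin> E"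
    by (auto simp: card_1_singleton_iff)
  have out: "{e \<in> ?M. e \<inter> {u, v} = {}} = {}" using eqs(1) missing_facts(1)[of E]
    by (subst (asm) card_eq_0_iff) (auto intro: finite_subset)
  obtain e where e: "e \<in> E" "representing c V (insert {u, v} (E - {e}))"
    using representing_swap[OF E f] by blast
  let ?E' = "insert {u, v} (E - {e})"
  note swap = degree_swap[OF rep_finite[OF E] e(1) f(2)]
  \<comment> \<open>Such a vertex misses at most its edges to \<open>u\<close> and \<open>v\<close>,
    so it has degree at least 5, and the exchange costs at most one.\<close>
  have big: "4 \<le> degree ?E' w" if w: "w \<in> V" "w \<noteq> u" "w \<noteq> v" for w
  proof -
    have "{e \<in> ?M. w \<in> e} \<subseteq> {{w, u}, {w, v}}"
    proof
      fix e' assume e': "e' \<in> {e \<in> ?M. w \<in> e}"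
      then obtain x where "e' = {w, x}" by (auto elim!: pairs_cases[of e' V w])
      moreover have "e' \<inter> {u, v} \<noteq> {}" using out e' by blast
      ultimately show "e' \<in> {{w, u}, {w, v}}" using w by auto
    qed
    then have "degree ?M w \<le> card {{w, u}, {w, v}}" unfolding degree_def by (rule card_mono[rotated]) simp
    also have "\<dots> \<le> 2" by (simp add: card_insert_if)
    finally show ?thesis using dM[OF w(1)] swap[of w] n w by (auto split: if_splits)
  qed
  \<comment> \<open>The lost edge meets at most one of \<open>u\<close> and \<open>v\<close>, so the
    other one ends with degree 2.\<close>
  have "e \<noteq> {u, v}" using e(1) f(2) by blast
  moreover have "card e = 2" using e(1) rep_subset[OF E] by (auto simp: pairs_def)
  ultimately have "\<not> (u \<in> e \<and> v \<in> e)" using uv(3) by (auto simp: card_2_iff)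
  then have low: "degree ?E' u \<ge> 1" "degree ?E' v \<ge> 1" "degree ?E' u \<ge> 2 \<or> degree ?E' v \<ge> 2"
    using swap[of u] swap[of v] eqs by (auto split: if_splits)
  show False
    using finite_V card_V rep_subset[OF e(2)] few_missing[OF e(2)] nontraceable[OF e(2)]
  proof (cases rule: nontraceable_dense)
    case (isolated w)
    then show False using big[of w] low by (cases "w = u"; cases "w = v") auto
  next
    case (two_leaves x y)
    then have "x = u \<or> x = v" "y = u \<or> y = v" using big[of x] big[of y] by force+
    then show False using two_leaves low by auto
  next
    case (five A)
    have "A \<subseteq> {u, v}" using five big by force
    then have "card A \<le> card {u, v}" by (intro card_mono) auto
    also have "\<dots> \<le> 2" by (simp add: card_insert_if)
    finally show False using five by simp
  qed
qed

text \<open>The edge \<open>{a1, a2}\<close> starts one path, so no edge from \<open>a1\<close> to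
  the outside of \<open>A\<close> is required. The other edges used join \<open>A - {a1}\<close> to
  its complement, and the freedom in choosing them avoids one exceptional pair \<open>x0\<close>,
  \<open>b0\<close>.\<close>

lemma no_five_with_inner_edge:
  assumes E: "representing c V E" and A: "card V = 8" "A \<subseteq> V" "card A = 5"
    and a: "a1 \<in> A" "a2 \<in> A" "a1 \<noteq> a2" "{a1, a2} \<in> E"
    and most: "\<And>x b. x \<in> A - {a1} \<Longrightarrow> b \<in> V - A \<Longrightarrow> {x, b} \<in> E \<or> x = x0 \<and> b = b0"
  shows False
proof -
  have fA: "finite A" using A finite_V finite_subset by blast
  have B: "card (V - A) = 3" using A fA by (simp add: card_Diff_subset)
  have "card (V - A - {b0}) \<noteq> 0" using B by (cases "b0 \<in> V - A") auto
  then obtain b2 where b2: "b2 \<in> V - A" "b2 \<noteq> b0" by (metis Diff_iff card.empty equals0I insertI1)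
  have "card (V - A - {b2}) = 2" using B b2 by simp
  then obtain b3 b4 where b: "V - A - {b2} = {b3, b4}" "b3 \<noteq> b4" by (auto simp: card_2_iff)
  have C: "card (A - {a1, a2}) = 3" using A a fA by (simp add: card_Diff_subset)
  then have "A - {a1, a2} \<noteq> {}" using card_gt_0_iff[of "A - {a1, a2}"] by linarith
  then obtain a5 where a5: "a5 \<in> A - {a1, a2}" "x0 \<in> A - {a1, a2} \<Longrightarrow> a5 = x0" by blast
  have "card (A - {a1, a2} - {a5}) = 2" using C a5 by simp
  then obtain a3 a4 where a34: "A - {a1, a2} - {a5} = {a3, a4}" "a3 \<noteq> a4" by (auto simp: card_2_iff)
  have VB: "V - A = {b2, b3, b4}" using b b2 by blast
  have VA: "A = {a1, a2, a3, a4, a5}" using a34 a5 a by blast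
  have mem: "a3 \<in> A" "a4 \<in> A" "b3 \<in> V - A" "b4 \<in> V - A" "a3 \<notin> {a1, a2, a5}" "a4 \<notin> {a1, a2, a5}"
    "b3 \<noteq> b2" "b4 \<noteq> b2" using a34 b by blast+
  have "a3 \<noteq> x0" "a4 \<noteq> x0" using a5 mem by blast+
  then have ed: "{a2, b2} \<in> E" "{b2, a5} \<in> E" "{a3, b3} \<in> E" "{b3, a4} \<in> E" "{a4, b4} \<in> E"
    using most[of a2 b2] most[of a5 b2] most[of a3 b3] most[of a4 b3] most[of a4 b4]
      a a5 b2 mem by (auto simp: insert_commute)
  \<comment> \<open>This order uses no edge from \<open>a1\<close> to the outside of \<open>A\<close>, and \<open>a5\<close>, \<open>b2\<close> were chosen so that
    the exceptional pair \<open>(x0, b0)\<close> is not used either.\<close>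
  let ?p = "[a1, a2, b2, a5, a3, b3, a4, b4]"
  have "distinct ?p" using a a5 a34 b b2 mem by auto
  moreover have "set ?p = V" using VA VB A(2) by auto
  moreover have "{?p ! i, ?p ! Suc i} \<in> E" if "Suc i < length ?p" "i mod 4 \<noteq> 3" for i
  proof -
    have "i < 7" using that(1) by simp
    \<comment> \<open>Position 3, between \<open>a5\<close> and \<open>a3\<close>, is the gap
      between the two paths.\<close>
    then have "i = 0 \<or> i = 1 \<or> i = 2 \<or> i = 4 \<or> i = 5 \<or> i = 6" using that(2) by presburger
    then show ?thesis using a(4) ed by (elim disjE) simp_all
  qed
  ultimately have "P4_factor V E" unfolding P4_factor_def by blast
  then show False using no_factor[OF E] by blast
qed

text \<open>Each vertex of \<open>A\<close> misses at least 4 edges, while at most 11 edges are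
  missing in all, so at least 9 of the 10 pairs inside \<open>A\<close> are missing and almost no
  others. If all 10 are missing, an inner edge is brought in by an exchange; otherwise the remaining
  inner edge serves.\<close>

lemma no_five:
  assumes E: "representing c V E" and A: "card V = 8" "A \<subseteq> V" "card A = 5"
    and deg: "\<And>a. a \<in> A \<Longrightarrow> degree E a \<le> 3"
  shows False
proof -
  let ?M = "pairs V - E"
  define X where "X = {e \<in> ?M. \<not> e \<subseteq> A}"
  define Y where "Y = {e \<in> ?M. e \<subseteq> A}"
  have fA: "finite A" using A finite_V finite_subset by blast
  have fX: "finite X" unfolding X_def using missing_facts(1) by (rule finite_subset[rotated]) blast
  have fP: "finite (pairs A)" "card (pairs A) = 10" using fA A(3) by (simp_all add: finite_pairs card_pairs choose_two)
  have YP: "Y \<subseteq> pairs A" by (auto simp: Y_def pairs_def)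
  have dM: "4 \<le> degree ?M a" if "a \<in> A" for a
    using degree_complement[OF finite_V _ rep_subset[OF E], of a] deg[OF that] A that by auto
  have "card A * 4 \<le> (\<Sum>a\<in>A. degree ?M a)"
    using sum_bounded_below[of A 4 "degree ?M"] dM by simp
  then have "20 \<le> card ?M + card Y"
    using sum_degree[OF missing_facts(1) fA missing_facts(2), of E] A(3) by (simp add: Y_def)
  moreover have "card ?M = card X + card Y"
  proof -
    have "finite Y" unfolding Y_def using missing_facts(1) by (rule finite_subset[rotated]) blast
    moreover have "?M = X \<union> Y" "X \<inter> Y = {}" by (auto simp: X_def Y_def)
    ultimately show ?thesis using fX by (simp add: card_Un_disjoint)
  qed
  moreover have "card ?M \<le> 11" using few_missing[OF E] A(1) by simp
  moreover have "card Y \<le> 10" using card_mono[OF fP(1) YP] fP(2) by simp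
  ultimately have cards: "card Y = 10 \<and> card X \<le> 1 \<or> card Y = 9 \<and> card X \<le> 2" by linarith
  have cross: "{x, b} \<in> E \<or> {x, b} \<in> X" if "x \<in> A" "b \<in> V - A" for x b
    using that A(2) by (auto simp: X_def doubleton_in_pairs)
  \<comment> \<open>If no pair of \<open>Z\<close> joins the two sides, any \<open>x0\<close> and
    \<open>b0\<close> will do.\<close>
  have uniq: "\<exists>x0 b0. \<forall>x\<in>A - {a}. \<forall>b\<in>V - A. {x, b} \<in> Z \<longrightarrow> x = x0 \<and> b = b0"
    if "card Z \<le> 1" "finite Z" for Z a
  proof (cases "\<exists>x\<in>A - {a}. \<exists>b\<in>V - A. {x, b} \<in> Z")
    case True
    then obtain x0 b0 where x0: "x0 \<in> A - {a}" "b0 \<in> V - A" "{x0, b0} \<in> Z" by blast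
    have "x = x0 \<and> b = b0" if "x \<in> A - {a}" "b \<in> V - A" "{x, b} \<in> Z" for x b
    proof -
      have "{x, b} = {x0, b0}" using that(3) x0(3) \<open>card Z \<le> 1\<close> card_le_Suc0_iff_eq[OF \<open>finite Z\<close>]
        by auto
      then show ?thesis using that x0 by (auto simp: doubleton_eq_iff)
    qed
    then show ?thesis by blast
  qed blast
  from cards show False
  proof
    assume c: "card Y = 10 \<and> card X \<le> 1"
    then have Y: "Y = pairs A" using card_subset_eq[OF fP(1) YP] fP(2) by simp
    have X1: "m = m'" if "m \<in> X" "m' \<in> X" for m m'
      using c that fX by (metis card_le_Suc0_iff_eq One_nat_def)
    have "A \<noteq> {}" using A(3) by auto
    \<comment> \<open>The only missing edge that may leave \<open>A\<close> is put at
      \<open>a1\<close>, where it does no harm. The sole exceptional pair is then the edge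
      \<open>e\<close> lost in the exchange.\<close>
    then obtain a1 where a1: "a1 \<in> A" "\<And>m. m \<in> X \<Longrightarrow> m \<inter> A \<noteq> {} \<Longrightarrow> a1 \<in> m"
      using X1 by (metis Int_iff all_not_in_conv)
    have "card (A - {a1}) = 4" using A(3) a1(1) by simp
    then have "A - {a1} \<noteq> {}" using card.empty by (metis zero_neq_numeral)
    then obtain a2 where a2: "a2 \<in> A" "a1 \<noteq> a2" by blast
    have f: "{a1, a2} \<in> pairs V" "{a1, a2} \<notin> E"
      using a1 a2 A(2) Y doubleton_in_pairs[of a1 a2 A] by (auto simp: Y_def)
    obtain e where e: "e \<in> E" "representing c V (insert {a1, a2} (E - {e}))"
      using representing_swap[OF E f] by blast
    have "\<exists>x0 b0. \<forall>x\<in>A - {a1}. \<forall>b\<in>V - A. {x, b} \<in> {e} \<longrightarrow> x = x0 \<and> b = b0"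
      by (rule uniq) simp_all
    then obtain x0 b0 where u: "\<forall>x\<in>A - {a1}. \<forall>b\<in>V - A. {x, b} \<in> {e} \<longrightarrow> x = x0 \<and> b = b0"
      by blast
    show False
    proof (rule no_five_with_inner_edge[OF e(2) A a1(1) a2(1) a2(2)])
      fix x b assume x: "x \<in> A - {a1}" "b \<in> V - A"
      have "{x, b} \<notin> X" using a1(2)[of "{x, b}"] a1(1) x by auto
      then show "{x, b} \<in> insert {a1, a2} (E - {e}) \<or> x = x0 \<and> b = b0"
        using u x cross[of x b] by blast
    qed simp
  next
    assume c: "card Y = 9 \<and> card X \<le> 2"
    then have "card (pairs A - Y) = 1" using fP YP finite_subset[OF YP] by (simp add: card_Diff_subset)
    then obtain f where f: "pairs A - Y = {f}" by (auto simp: card_1_singleton_iff)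
    then have "f \<in> pairs A" "f \<notin> Y" by blast+
    then obtain a1 a2 where a: "f = {a1, a2}" "a1 \<in> A" "a2 \<in> A" "a1 \<noteq> a2"
      by (auto simp: pairs_def card_2_iff)
    have fE: "{a1, a2} \<in> E" using \<open>f \<notin> Y\<close> A(2) a by (auto simp: Y_def pairs_def)
    \<comment> \<open>Inside \<open>A\<close> the vertex \<open>a1\<close> misses only 3 edges, so
      one of its 4 or more missing edges leaves \<open>A\<close>. That leaves at most one
      exceptional pair away from \<open>a1\<close>.\<close>
    have "\<exists>m\<in>X. a1 \<in> m"
    proof (rule ccontr)
      assume no: "\<not> (\<exists>m\<in>X. a1 \<in> m)"
      have "{e \<in> ?M. a1 \<in> e} \<subseteq> {e \<in> pairs A. a1 \<in> e} - {f}"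
      proof safe
        fix e assume "e \<in> pairs V" "e \<notin> E" "a1 \<in> e"
        then show "e \<in> pairs A" using no by (auto simp: X_def pairs_def)
      qed (use fE a in auto)
      then have "degree ?M a1 \<le> card ({e \<in> pairs A. a1 \<in> e} - {f})"
        unfolding degree_def using fP by (intro card_mono) auto
      also have "\<dots> = 3"
        using degree_pairs[OF fA a(2)] A(3) a(1) f fP by (simp add: degree_def card_Diff_singleton_if) blast
      finally show False using dM[OF a(2)] by simp
    qed
    then obtain m where m: "m \<in> X" "a1 \<in> m" by blast
    have "card (X - {m}) \<le> 1" using c card_Diff_singleton[OF m(1)] by linarith
    then obtain x0 b0 where u: "\<forall>x\<in>A - {a1}. \<forall>b\<in>V - A. {x, b} \<in> X - {m} \<longrightarrow> x = x0 \<and> b = b0"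
      using uniq[of "X - {m}"] fX by blast
    show False
    proof (rule no_five_with_inner_edge[OF E A a(2,3,4) fE])
      fix x b assume x: "x \<in> A - {a1}" "b \<in> V - A"
      have "{x, b} \<noteq> m" using x m(2) a(2) by auto
      then show "{x, b} \<in> E \<or> x = x0 \<and> b = b0"
        using u x cross[of x b] by blast
    qed
  qed
qed

text \<open>After bringing in any edge at \<open>v\<close>, the patterns excluded before cannot
  occur. A vertex \<open>y\<close> isolated now differs from \<open>v\<close> and had degree at most
  1 in \<open>E\<close>, so \<open>v\<close> and \<open>y\<close> were two forbidden leaves of
  \<open>E\<close>.\<close>

lemma no_isolated:
  assumes E: "representing c V E" and v: "v \<in> V" "degree E v = 0"
  shows False
proof -
  let ?M = "pairs V - E" and ?n = "card V"
  have n: "8 \<le> ?n" using card_V by auto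
  have "V - {v} \<noteq> {}"
  proof
    assume "V - {v} = {}"
    then have "card V \<le> card {v}" by (intro card_mono) auto
    then show False using n by simp
  qed
  then obtain x where x: "x \<in> V" "v \<noteq> x" by blast
  have no: "v \<notin> e" if "e \<in> E" for e
    using v(2) that rep_finite[OF E] by (auto simp: degree_def)
  have f: "{v, x} \<in> pairs V" "{v, x} \<notin> E" using v x no by (auto simp: doubleton_in_pairs)
  obtain e where e: "e \<in> E" "representing c V (insert {v, x} (E - {e}))"
    using representing_swap[OF E f] by blast
  note swap = degree_swap[OF rep_finite[OF E] e(1) f(2)]
  show False
    using finite_V card_V rep_subset[OF e(2)] few_missing[OF e(2)] nontraceable[OF e(2)]
  proof (cases rule: nontraceable_dense)
    case (isolated y)
    have "v \<noteq> y" using isolated swap[of v] no e(1) by auto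
    moreover have "degree E y \<le> 1" using isolated swap[of y] by (auto split: if_splits)
    ultimately show False using no_two_leaves[OF E v(1), of y] v isolated by auto
  next
    case (two_leaves x y)
    then show False using no_two_leaves[OF e(2)] by blast
  next
    case (five A)
    then show False using no_five[OF e(2)] by blast
  qed
qed

end

lemma dense_colouring_P4_factor:
  assumes "finite V" and "card V = 8 \<or> 11 \<le> card V"
    and "(card V choose 2) + 5 \<le> card (c ` pairs V) + 2 * card V"
  obtains E where "representing c V E" "P4_factor V E"
proof (rule ccontr)
  assume "\<not> thesis"
  then interpret dense_colouring V c
    using assms that by unfold_locales blast+
  \<comment> \<open>One edge is chosen from each colour class.\<close>
  obtain E where E: "representing c V E"
    using subset_image_inj[of "c ` pairs V" c "pairs V", THEN iffD1, OF order_refl]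
    by (auto simp: representing_def)
  show False
    using finite_V card_V rep_subset[OF E] few_missing[OF E] nontraceable[OF E]
  proof (cases rule: nontraceable_dense)
    case (isolated v)
    then show False using no_isolated[OF E] by blast
  next
    case (two_leaves x y)
    then show False using no_two_leaves[OF E] by blast
  next
    case (five A)
    then show False using no_five[OF E] by blast
  qed
qed

section \<open>Rainbow copies of \<open>kP_4\<close> and the extremal colouring\<close>

lemma edges_path_graph_4: "edges (path_graph 4) = {{0, 1}, {1, 2}, {2, 3}}"
proof -
  have "Suc i < 4 \<longleftrightarrow> i = 0 \<or> i = 1 \<or> i = 2" for i by presburger
  then show ?thesis by (auto simp: path_graph_def numeral_2_eq_2 numeral_3_eq_3)
qed

lemma P4_factor_rainbow_copy:
  assumes E: "representing c {..<4 * k} E" and P: "P4_factor {..<4 * k} E"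
  shows "has_rainbow_copy c (complete_graph (4 * k)) (disjoint_copies k (path_graph 4))"
proof -
  obtain p where p: "distinct p" "set p = {..<4 * k}"
    "\<And>i. Suc i < length p \<Longrightarrow> i mod 4 \<noteq> 3 \<Longrightarrow> {p ! i, p ! Suc i} \<in> E"
    using P unfolding P4_factor_def by blast
  have len: "length p = 4 * k" using distinct_card[OF p(1)] p(2) by simp
  let ?H = "disjoint_copies k (path_graph 4)"
  \<comment> \<open>Vertex \<open>j\<close> of copy \<open>i\<close> goes to position
    \<open>4 * i + j\<close>, so the copies are the blocks of four entries of
    \<open>p\<close>.\<close>
  define g :: "nat \<times> nat \<Rightarrow> nat" where "g = (\<lambda>(i, j). 4 * i + j)"
  define f where "f = (\<lambda>x. p ! g x)"
  have V: "verts ?H = {..<k} \<times> {..<4}" by (simp add: disjoint_copies_def path_graph_def)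
  have g: "bij_betw g ({..<k} \<times> {..<4}) {..<4 * k}"
    by (rule bij_betw_byWitness[where f' = "\<lambda>m. (m div 4, m mod 4)"]) (auto simp: g_def)
  have "bij_betw ((!) p) {..<4 * k} {..<4 * k}"
    using bij_betw_nth[OF p(1) refl refl] unfolding len p(2) .
  with g have f: "bij_betw f (verts ?H) {..<4 * k}"
    unfolding V f_def using bij_betw_trans[of g _ _ "(!) p"] by (simp add: comp_def)
  define F where "F = \<lparr>verts = {..<4 * k}, edges = (\<lambda>e. f ` e) ` edges ?H\<rparr>"
  have FE: "edges F \<subseteq> E"
  proof
    fix e assume "e \<in> edges F"
    then obtain i e' where i: "i < k" "e' \<in> edges (path_graph 4)" "e = f ` Pair i ` e'"
      by (auto simp: F_def disjoint_copies_def)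
    then obtain j where j: "j < 3" "e = f ` Pair i ` {j, Suc j}"
      by (auto simp: edges_path_graph_4 numeral_2_eq_2 numeral_3_eq_3)
    \<comment> \<open>As \<open>j < 3\<close>, the edge stays inside one block.\<close>
    have "Suc (4 * i + j) < length p" "(4 * i + j) mod 4 \<noteq> 3" using i(1) j(1) len by auto
    then show "e \<in> E" using p(3)[of "4 * i + j"] j(2) by (simp add: f_def g_def)
  qed
  have Ec: "E \<subseteq> edges (complete_graph (4 * k))" "inj_on c E"
    using E by (auto simp: representing_def pairs_def complete_graph_def)
  have "simple_graph F"
    using FE Ec(1) by (auto simp: simple_graph_def F_def complete_graph_def)
  then have "subgraph F (complete_graph (4 * k))"
    using FE Ec(1) by (auto simp: subgraph_def F_def complete_graph_def)
  moreover have "graph_iso ?H F" unfolding graph_iso_def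
    by (rule exI[of _ f]) (use f in \<open>simp add: F_def\<close>)
  moreover have "rainbow c F"
    unfolding rainbow_def using inj_on_subset[OF Ec(2) FE] .
  ultimately show ?thesis unfolding has_rainbow_copy_def by blast
qed

text \<open>No component of \<open>kP_4\<close> is a single vertex or a single edge, so two vertices
  never depend on one common edge. This forces the repeated colour in the extremal
  colouring.\<close>

lemma distinct_edges_at_distinct_vertices:
  assumes "x \<in> verts (disjoint_copies k (path_graph 4))"
    "y \<in> verts (disjoint_copies k (path_graph 4))" "x \<noteq> y"
  obtains d e where "d \<in> edges (disjoint_copies k (path_graph 4))"
    "e \<in> edges (disjoint_copies k (path_graph 4))" "x \<in> d" "y \<in> e" "d \<noteq> e"
proof -
  let ?P = "edges (path_graph 4)" and ?E = "edges (disjoint_copies k (path_graph 4))"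
  obtain i a j b where xy: "x = (i, a)" "y = (j, b)" "i < k" "j < k" "a < 4" "b < 4"
    using assms by (auto simp: disjoint_copies_def path_graph_def)
  have ab: "a = 0 \<or> a = 1 \<or> a = 2 \<or> a = 3" "b = 0 \<or> b = 1 \<or> b = 2 \<or> b = 3"
    using xy(5,6) by linarith+
  have edge: "Pair l ` d \<in> ?E" if "l < k" "d \<in> ?P" for l d
    using that by (auto simp: disjoint_copies_def)
  show ?thesis
  proof (cases "i = j")
    case True
    then have "a \<noteq> b" using xy assms(3) by blast
    then have "\<exists>d\<in>?P. \<exists>e\<in>?P. a \<in> d \<and> b \<in> e \<and> d \<noteq> e"
      using ab unfolding edges_path_graph_4 by (elim disjE) (simp_all add: doubleton_eq_iff)
    then obtain d e where de: "d \<in> ?P" "e \<in> ?P" "a \<in> d" "b \<in> e" "d \<noteq> e" by blast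
    then have "Pair i ` d \<noteq> Pair j ` e"
      using True inj_image_eq_iff[of "Pair i" d e] by (simp add: inj_on_def)
    then show ?thesis using that edge[OF xy(3) de(1)] edge[OF xy(4) de(2)] de xy by blast
  next
    case False
    have "\<exists>d\<in>?P. a \<in> d" "\<exists>e\<in>?P. b \<in> e" using ab unfolding edges_path_graph_4 by auto
    then obtain d e where de: "d \<in> ?P" "e \<in> ?P" "a \<in> d" "b \<in> e" by blast
    then have "Pair i ` d \<noteq> Pair j ` e" using False by auto
    then show ?thesis using that edge[OF xy(3) de(1)] edge[OF xy(4) de(2)] de xy by blast
  qed
qed

lemma rainbow_clique_colouring:
  assumes "k \<ge> 2"
  shows "((4 * k - 2) choose 2) + 1 \<in>
    rainbow_free_color_counts (4 * k) (disjoint_copies k (path_graph 4))"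
proof -
  let ?H = "disjoint_copies k (path_graph 4)" and ?K = "complete_graph (4 * k)"
  let ?P = "pairs {..<4 * k - 2}"
  let ?u = "4 * k - 2" and ?v = "4 * k - 1"
  obtain g :: "nat set \<Rightarrow> nat" where g: "inj_on g ?P"
    using finite_imp_inj_to_nat_seg[OF finite_pairs[of "{..<4 * k - 2}"]] by auto
  \<comment> \<open>Colour 0 is shared by all edges outside the clique; \<open>Suc\<close> keeps it
    apart from the clique colours.\<close>
  define c where "c = (\<lambda>e. if e \<in> ?P then Suc (g e) else 0)"
  have K: "edges ?K = pairs {..<4 * k}" by (simp add: complete_graph_def pairs_def)
  have sub: "?P \<subseteq> edges ?K" unfolding K by (auto simp: pairs_def)
  \<comment> \<open>This edge witnesses that colour 0 occurs, which gives the summand 1.\<close>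
  have uv: "{?u, ?v} \<in> edges ?K - ?P"
    using assms unfolding K by (auto simp: doubleton_in_pairs)
  have "c ` edges ?K = insert 0 ((\<lambda>e. Suc (g e)) ` ?P)"
  proof -
    have "c ` ?P = (\<lambda>e. Suc (g e)) ` ?P" by (simp add: c_def)
    moreover have "c ` (edges ?K - ?P) = {0}" using uv by (auto simp: c_def)
    moreover have "c ` edges ?K = c ` ?P \<union> c ` (edges ?K - ?P)"
      using sub by (simp add: image_Un[symmetric] Un_absorb1)
    ultimately show ?thesis by simp
  qed
  moreover have "card ((\<lambda>e. Suc (g e)) ` ?P) = (4 * k - 2) choose 2"
    using g by (simp add: card_image inj_on_def card_pairs)
  ultimately have card: "card (c ` edges ?K) = ((4 * k - 2) choose 2) + 1"
    by (simp add: finite_pairs card_insert_if image_iff)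
  have "\<not> has_rainbow_copy c ?K ?H"
  proof
    assume "has_rainbow_copy c ?K ?H"
    then obtain F f where F: "subgraph F ?K" "inj_on c (edges F)"
      "bij_betw f (verts ?H) (verts F)" "(\<lambda>e. f ` e) ` edges ?H = edges F"
      unfolding has_rainbow_copy_def graph_iso_def rainbow_def by blast
    have "verts F \<subseteq> {..<4 * k}" using F(1) by (simp add: subgraph_def complete_graph_def)
    moreover have "card (verts F) = card {..<4 * k}"
      using bij_betw_same_card[OF F(3)] by (simp add: disjoint_copies_def path_graph_def card_cartesian_product)
    \<comment> \<open>A copy has \<open>4 * k\<close> vertices and hence spans, so it must cover
      both vertices outside the clique.\<close>
    ultimately have VF: "verts F = {..<4 * k}" by (simp add: card_subset_eq)
    have uvF: "?u \<in> f ` verts ?H" "?v \<in> f ` verts ?H" "?u \<noteq> ?v"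
      using assms VF F(3) by (auto simp: bij_betw_def)
    obtain x where x: "x \<in> verts ?H" "f x = ?u" using uvF(1) by force
    obtain y where y: "y \<in> verts ?H" "f y = ?v" using uvF(2) by force
    note xy = x(1) y(1) x(2) y(2)
    have "x \<noteq> y" using xy uvF(3) by auto
    then obtain d e where de: "d \<in> edges ?H" "e \<in> edges ?H" "x \<in> d" "y \<in> e" "d \<noteq> e"
      using distinct_edges_at_distinct_vertices[OF xy(1,2)] by blast
    have sub: "d \<subseteq> verts ?H" "e \<subseteq> verts ?H"
      using de simple_disjoint_copies[OF simple_path_graph, of k 4] by (auto simp: simple_graph_def)
    have "?u \<in> f ` d" "?v \<in> f ` e"
      using imageI[OF de(3), of f] imageI[OF de(4), of f] xy by simp_all
    then have "f ` d \<notin> ?P" "f ` e \<notin> ?P" by (auto simp: pairs_def)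
    then have "c (f ` d) = c (f ` e)" by (simp add: c_def)
    moreover have "f ` d \<in> edges F" "f ` e \<in> edges F" using de F(4) by blast+
    ultimately have "f ` d = f ` e" using F(2) by (simp add: inj_on_def)
    then show False
      using F(3) sub de(5) by (metis bij_betw_def inj_on_image_eq_iff)
  qed
  then show ?thesis
    using card unfolding rainbow_free_color_counts_def by force
qed

theorem theorem4:
  fixes k n :: nat
  assumes "k \<ge> 2" and "n = 4 * k"
  shows "anti_ramsey n (disjoint_copies k (path_graph 4)) = (2 * k - 1) * (4 * k - 3) + 1"
proof -
  let ?H = "disjoint_copies k (path_graph 4)"
  \<comment> \<open>Writing \<open>k\<close> as \<open>m + 1\<close> removes the truncated
    subtractions from the arithmetic below.\<close>
  obtain m where m: "k = m + 1" "m \<ge> 1" using assms(1)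
    by (metis Suc_eq_plus1 Suc_le_D numeral_2_eq_2 Suc_le_mono One_nat_def)
  have "2 * ((4 * k - 2) choose 2) = (4 * k - 2) * (4 * k - 3)"
    using times_binomial_minus1_eq[of 2 "4 * k - 2"] m by simp
  also have "\<dots> = 2 * ((2 * k - 1) * (4 * k - 3))" using m by (simp add: algebra_simps)
  finally have small: "(4 * k - 2) choose 2 = (2 * k - 1) * (4 * k - 3)" by simp
  have "2 * (n choose 2) = n * (n - 1)"
    using times_binomial_minus1_eq[of 2 n] m assms(2) by simp
  \<comment> \<open>By \<open>small\<close> the product is \<open>(n - 2) choose 2\<close>. One
    colour more than claimed is therefore exactly the threshold of
    \<open>dense_colouring_P4_factor\<close>.\<close>
  then have big: "(n choose 2) + 3 = (2 * k - 1) * (4 * k - 3) + 2 * n"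
    using m assms(2) by (simp add: algebra_simps)
  have "t \<le> (2 * k - 1) * (4 * k - 3) + 1" if t: "t \<in> rainbow_free_color_counts n ?H" for t
  proof (rule ccontr)
    assume gt: "\<not> t \<le> (2 * k - 1) * (4 * k - 3) + 1"
    obtain c :: "nat set \<Rightarrow> nat" where c: "t = card (c ` edges (complete_graph n))"
      "\<not> has_rainbow_copy c (complete_graph n) ?H"
      using t by (auto simp: rainbow_free_color_counts_def)
    have "edges (complete_graph n) = pairs {..<n}" by (simp add: complete_graph_def pairs_def)
    then have "(card {..<n} choose 2) + 5 \<le> card (c ` pairs {..<n}) + 2 * card {..<n}"
      using big gt c(1) by simp
    moreover have "card {..<n} = 8 \<or> 11 \<le> card {..<n}" using m assms(2) by auto
    ultimately obtain E where "representing c {..<n} E" "P4_factor {..<n} E"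
      using dense_colouring_P4_factor[of "{..<n}" c] by blast
    then show False using P4_factor_rainbow_copy c(2) assms(2) by blast
  qed
  moreover have "(2 * k - 1) * (4 * k - 3) + 1 \<in> rainbow_free_color_counts n ?H"
    using rainbow_clique_colouring[OF assms(1)] small assms(2) by simp
  ultimately show ?thesis
    unfolding anti_ramsey_def using finite_rainbow_free_color_counts by (intro Max_eqI) auto
qed

end
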